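(* Let $\mathbb{F}\in\{\mathbb{R},\mathbb{C}\}$ and let $\mathcal{A}=\{A_1,\ldots,A_K\}\subset\mathbb{M}(n,\mathbb{F})$. Fix $Q\in GL(n,\mathbb{F})$ and set $D_k=Q^{-1}A_kQ$ for $k=1,\ldots,K$. Then the gradient of $f_{\mathcal{A}}$ at $Q$ is $$\nabla f_{\mathcal{A}}|_Q=\sum_{k=1}^K Q^{-*}\big[D_k^*,\,D_k\diamond J\big].$$
   Context: $\mathbb{M}(n,\mathbb{F})$ is the set of $n\times n$ matrices over $\mathbb{F}$ and $GL(n,\mathbb{F})$ its subset of invertible matrices. $J$ is the $n\times n$ matrix with zeros on the diagonal and ones elsewhere, $X\diamond Y$ is the entrywise (Hadamard) product, $[X,Y]=XY-YX$, $X^*$ is the conjugate transpose and $Q^{-*}=(Q^{-1})^*$. The functional $f_{\mathcal{A}}:GL(n,\mathbb{F})\to[0,\infty)$ is $$f_{\mathcal{A}}(Q)=\frac12\sum_{k=1}^K\sum_{i\neq j}\left|(Q^{-1}A_kQ)_{ij}\right|^2.$$ $\mathbb{M}(n,\mathbb{F})$ is regarded as a real Hilbert space with scalar product $\langle A,B\rangle_{\mathbb{R}}=\mathrm{Re}\sum_{i,j}A_{ij}\overline{B_{ij}}$ and associated (Frobenius) norm $\|\cdot\|$. The gradient $\nabla g|_X$ of a real-valued function $g$ at $X$ is the unique matrix $Y\in\mathbb{M}(n,\mathbb{F})$ with $g(X+Z)=g(X)+\langle Y,Z\rangle_{\mathbb{R}}+o(\|Z\|)$ as $Z\to0$ in $\mathbb{M}(n,\mathbb{F})$.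 *)

theory Defs
  imports "HOL-Analysis.Analysis" "HOL-Library.Landau_Symbols"
begin

definition offdiag_ones :: "'a::zero_neq_one ^ 'n ^ 'n" where
  "offdiag_ones = (\<chi> i j. if i = j then 0 else 1)"

definition hadamard :: "'a::times ^ 'n ^ 'm \<Rightarrow> 'a ^ 'n ^ 'm \<Rightarrow> 'a ^ 'n ^ 'm"
    (infixl "\<diamondop>" 70) where
  "X \<diamondop> Y = (\<chi> i j. X $ i $ j * Y $ i $ j)"

definition mat_commutator :: "'a::ring_1 ^ 'n ^ 'n \<Rightarrow> 'a ^ 'n ^ 'n \<Rightarrow> 'a ^ 'n ^ 'n" where
  "mat_commutator X Y = X ** Y - Y ** X"

text \<open>Over the reals the conjugate transpose is the library's transpose, see
  \<open>conj_transpose_of_real\<close> below.\<close>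

definition conj_transpose :: "complex ^ 'n ^ 'm \<Rightarrow> complex ^ 'm ^ 'n" where
  "conj_transpose X = (\<chi> i j. cnj (X $ j $ i))"

lemma conj_transpose_of_real:
  "conj_transpose (\<chi> i j. complex_of_real (X $ i $ j)) =
     (\<chi> i j. complex_of_real (transpose X $ i $ j))"
  by (simp add: conj_transpose_def transpose_def vec_eq_iff)

text \<open>The functional is meant for invertible \<open>Q\<close> only; the values at singular \<open>Q\<close> are
  unspecified, because \<open>matrix_inv\<close> is. They do not affect derivatives at an invertible matrix,
  since the invertible matrices form an open set.\<close>

definition offdiag_fun :: "nat \<Rightarrow> (nat \<Rightarrow> 'a::real_normed_field ^ 'n ^ 'n) \<Rightarrow> 'a ^ 'n ^ 'n \<Rightarrow> real"
  where
  "offdiag_fun K A Q =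
     (1/2) * (\<Sum>k = 1..K. \<Sum>(i, j) \<in> {(i, j). i \<noteq> j}. (norm ((matrix_inv Q ** A k ** Q) $ i $ j))\<^sup>2)"

text \<open>Gradients are expressed by the library's \<open>GDERIV g X :> Y\<close>. The following facts record
  that on matrices its inner product is the real Frobenius scalar product, that it is the
  first-order expansion with remainder \<open>o(\<parallel>Z\<parallel>)\<close>, and that it determines \<open>Y\<close>.\<close>

lemma inner_complex_matrix:
  fixes A B :: "complex ^ 'n ^ 'm"
  shows "inner A B = Re (\<Sum>i\<in>UNIV. \<Sum>j\<in>UNIV. A $ i $ j * cnj (B $ i $ j))"
  by (simp add: inner_vec_def inner_complex_def)

lemma inner_real_matrix:
  fixes A B :: "real ^ 'n ^ 'm"
  shows "inner A B = (\<Sum>i\<in>UNIV. \<Sum>j\<in>UNIV. A $ i $ j * B $ i $ j)"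
  by (simp add: inner_vec_def)

lemma GDERIV_iff_smallo:
  fixes g :: "'a::real_inner \<Rightarrow> real"
  shows "GDERIV g X :> Y \<longleftrightarrow> (\<lambda>Z. g (X + Z) - (g X + inner Y Z)) \<in> o[at 0](norm)"
proof -
  have "(\<lambda>Z. g (X + Z) - (g X + inner Y Z)) \<in> o[at 0](norm) \<longleftrightarrow>
        ((\<lambda>Z. (g (X + Z) - (g X + inner Y Z)) / norm Z) \<longlongrightarrow> 0) (at 0)"
    by (rule iffI, erule smalloD_tendsto, erule smalloI_tendsto) (simp add: eventually_at_filter)
  also have "\<dots> \<longleftrightarrow>
      ((\<lambda>Z. norm ((g (X + Z) - (g X + inner Y Z)) / norm Z)) \<longlongrightarrow> 0) (at 0)"
    by (rule tendsto_norm_zero_iff[symmetric])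
  also have "(\<lambda>Z. norm ((g (X + Z) - (g X + inner Y Z)) / norm Z)) =
      (\<lambda>Z. norm (g (X + Z) - g X - inner Z Y) / norm Z)"
    by (simp only: abs_divide inner_commute[of Y] diff_diff_eq real_norm_def abs_norm_cancel)
  finally show ?thesis
    by (simp only: gderiv_def has_derivative_at bounded_linear_inner_left simp_thms)
qed

lemma GDERIV_imp_eq:
  fixes g :: "'a::real_inner \<Rightarrow> real"
  assumes "GDERIV g X :> Y" "GDERIV g X :> Y'"
  shows "Y = Y'"
proof -
  have "(\<lambda>h. inner h Y) = (\<lambda>h. inner h Y')"
    using assms unfolding gderiv_def by (rule has_derivative_unique)
  then have "inner (Y - Y') Y = inner (Y - Y') Y'" by (rule fun_cong)
  then have "inner (Y - Y') (Y - Y') = 0" by (simp add: inner_diff_right)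
  then show ?thesis by simp
qed

end

theory Submission
  imports Defs
begin

text \<open>
  Write \<open>D(X) = X\<^sup>-\<^sup>1 A X\<close> and let \<open>M \<diamondop> J\<close> be the off-diagonal part of \<open>M\<close>. The functional is a
  sum of terms \<open>(1/2) \<parallel>D(X) \<diamondop> J\<parallel>\<^sup>2\<close>. Since \<open>X\<^sup>-\<^sup>1\<close> has derivative
  \<open>H \<mapsto> - Q\<^sup>-\<^sup>1 H Q\<^sup>-\<^sup>1\<close> at \<open>Q\<close>, the derivative of \<open>D\<close> is the commutator \<open>H \<mapsto> [D, Q\<^sup>-\<^sup>1 H]\<close>
  (\<open>has_derivative_matrix_conjugate\<close>). The off-diagonal part is an orthogonal projection, so the
  derivative of one term of the functional is \<open>\<langle>[D, Q\<^sup>-\<^sup>1 H], D \<diamondop> J\<rangle>\<close>. For the Frobenius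
  product, multiplication by \<open>X\<close> from either side has multiplication by \<open>X\<^sup>*\<close> from the same side as
  its adjoint; moving first \<open>D\<close> and then \<open>Q\<^sup>-\<^sup>1\<close> to the right-hand factor gives
  \<open>\<langle>H, Q\<^sup>-\<^sup>* [D\<^sup>*, D \<diamondop> J]\<rangle>\<close>, from which the gradient is read off.

  The real and the complex case differ only in the conjugation of scalars, which enters through one
  property: multiplication by the conjugate of \<open>a\<close> is the adjoint of multiplication by \<open>a\<close> for the
  real scalar product of the field. The argument is therefore carried out once, for a normed field
  that is a Euclidean space and for any map \<open>c\<close> with this property.
\<close>

section \<open>The derivative of the matrix inverse\<close>

lemma bounded_bilinear_matrix_mult:
  "bounded_bilinear ((**) :: 'a::{real_normed_field,euclidean_space}^'n^'m \<Rightarrow> 'a^'p^'n \<Rightarrow> 'a^'p^'m)"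
proof -
  have "bilinear ((**) :: 'a^'n^'m \<Rightarrow> 'a^'p^'n \<Rightarrow> 'a^'p^'m)"
    unfolding bilinear_def
    by (auto intro!: linearI simp: matrix_matrix_mult_def vec_eq_iff algebra_simps
        sum.distrib scaleR_sum_right)
  then show ?thesis
    by (simp add: bilinear_conv_bounded_bilinear)
qed

lemmas matrix_mult_diff_left =
  bounded_bilinear.diff_left[OF bounded_bilinear_matrix_mult]
lemmas matrix_mult_diff_right =
  bounded_bilinear.diff_right[OF bounded_bilinear_matrix_mult]
lemmas matrix_mult_minus_left =
  bounded_bilinear.minus_left[OF bounded_bilinear_matrix_mult]

lemma matrix_inv_mult:
  assumes "invertible X"
  shows "X ** matrix_inv X = mat 1" "matrix_inv X ** X = mat 1"
  using someI_ex[OF assms[unfolded invertible_def]] unfolding matrix_inv_def by auto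

lemma isCont_det:
  fixes Q :: "'a::real_normed_field^'n^'n"
  shows "isCont det Q"
  unfolding det_def by (intro continuous_intros)

lemma eventually_invertible:
  fixes Q :: "'a::real_normed_field^'n^'n"
  assumes "invertible Q"
  shows "\<forall>\<^sub>F X in nhds Q. invertible X"
  using tendsto_imp_eventually_ne[OF isCont_det[of Q, unfolded isCont_def]] assms
  by (simp add: invertible_det_nz eventually_nhds_conv_at)

text \<open>The analogue of \<open>1/x - 1/q = - (1/q) (x - q) (1/x)\<close>. Applied once, it bounds \<open>X\<^sup>-\<^sup>1\<close> near \<open>Q\<close>
  and gives continuity; substituted into itself, it shows that the error of the linear
  approximation is quadratic.\<close>

lemma matrix_inv_diff:
  fixes Q X :: "'a::{real_normed_field,euclidean_space}^'n^'n"
  assumes "invertible Q" "invertible X"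
  shows "matrix_inv X - matrix_inv Q = - (matrix_inv Q ** ((X - Q) ** matrix_inv X))"
proof -
  have "matrix_inv Q ** ((X - Q) ** matrix_inv X)
      = matrix_inv Q ** (X ** matrix_inv X) - (matrix_inv Q ** Q) ** matrix_inv X"
    by (simp add: matrix_mult_diff_left matrix_mult_diff_right matrix_mul_assoc)
  then show ?thesis
    by (simp add: matrix_inv_mult assms)
qed

lemma has_derivative_matrix_inv:
  fixes Q :: "'a::{real_normed_field,euclidean_space}^'n^'n"
  assumes Q: "invertible Q"
  shows "(matrix_inv has_derivative (\<lambda>H. - (matrix_inv Q ** (H ** matrix_inv Q)))) (at Q)"
proof -
  interpret mm: bounded_bilinear "(**) :: 'a^'n^'n \<Rightarrow> 'a^'n^'n \<Rightarrow> 'a^'n^'n"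
    by (rule bounded_bilinear_matrix_mult)
  define R where "R = matrix_inv Q"
  obtain c where c: "c > 0" "\<forall>(X :: 'a^'n^'n) (Y :: 'a^'n^'n). norm (X ** Y) \<le> norm X * norm Y * c"
    using mm.pos_bounded by auto
  have bound3: "norm (R ** (Z ** Y)) \<le> (c\<^sup>2 * norm R) * norm Z * norm Y" for Z Y :: "'a^'n^'n"
  proof -
    have "norm (R ** (Z ** Y)) \<le> norm R * norm (Z ** Y) * c"
      using c by simp
    also have "\<dots> \<le> norm R * (norm Z * norm Y * c) * c"
      using c by (intro mult_right_mono mult_left_mono) auto
    finally show ?thesis
      by (simp add: power2_eq_square mult_ac)
  qed
  define b where "b = c\<^sup>2 * norm R"
  have b: "b \<ge> 0"
    by (simp add: b_def)
  have lin: "bounded_linear (\<lambda>H. - (R ** (H ** R)))"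
    by (intro bounded_linear_minus bounded_linear_compose[OF mm.bounded_linear_right]
        mm.bounded_linear_left)
  have "((\<lambda>X. b * norm (X - Q)) \<longlongrightarrow> b * norm (Q - Q)) (nhds Q)"
    by (intro tendsto_intros filterlim_ident)
  then have "\<forall>\<^sub>F X in nhds Q. b * norm (X - Q) < 1/2"
    by (rule order_tendstoD) simp
  \<comment> \<open>The threshold \<open>1/2\<close> makes the correction \<open>R H P\<close> at most half of \<open>P\<close>, whence \<open>\<parallel>P\<parallel> \<le> 2 \<parallel>R\<parallel>\<close>
      for \<open>P = X\<^sup>-\<^sup>1\<close>, \<open>R = Q\<^sup>-\<^sup>1\<close>, \<open>H = X - Q\<close>.\<close>
  with eventually_invertible[OF Q] have "\<forall>\<^sub>F X in nhds Q.
      norm (matrix_inv X - R - - (R ** ((X - Q) ** R))) / norm (X - Q) \<le> 2 * b\<^sup>2 * norm R * norm (X - Q)"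
  proof eventually_elim
    case (elim X)
    define P where "P = matrix_inv X"
    define H where "H = X - Q"
    have diff: "P - R = - (R ** (H ** P))"
      unfolding P_def R_def H_def using matrix_inv_diff[OF Q elim(1)] .
    have PR: "norm (P - R) \<le> b * norm H * norm P"
      using bound3[of H P] by (simp add: diff b_def)
    also have "\<dots> \<le> 1/2 * norm P"
      using elim unfolding H_def by (intro mult_right_mono) auto
    finally have "norm P \<le> 2 * norm R"
      using norm_triangle_ineq2[of P R] by linarith
    with PR have PR': "norm (P - R) \<le> b * norm H * (2 * norm R)"
      using b by (meson mult_left_mono mult_nonneg_nonneg norm_ge_zero order_trans)
    have "P - R - - (R ** (H ** R)) = - (R ** (H ** (P - R)))"
      by (subst diff) (simp add: mm.diff_right)
    then have "norm (P - R - - (R ** (H ** R))) \<le> b * norm H * norm (P - R)"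
      using bound3[of H "P - R"] by (simp add: b_def)
    also have "\<dots> \<le> b * norm H * (b * norm H * (2 * norm R))"
      using PR' b by (intro mult_left_mono) auto
    finally have "norm (P - R - - (R ** (H ** R))) \<le> 2 * b\<^sup>2 * norm R * norm H * norm H"
      by (simp add: power2_eq_square mult_ac)
    then show ?case
      unfolding P_def H_def by (cases "X = Q") (auto simp: divide_le_eq)
  qed
  then have ev: "\<forall>\<^sub>F X in at Q.
      norm (matrix_inv X - R - - (R ** ((X - Q) ** R))) / norm (X - Q) \<le> 2 * b\<^sup>2 * norm R * norm (X - Q)"
    by (simp add: eventually_at_filter eventually_mono)
  have "((\<lambda>X. 2 * b\<^sup>2 * norm R * norm (X - Q)) \<longlongrightarrow> 2 * b\<^sup>2 * norm R * norm (Q - Q)) (at Q)"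
    by (intro tendsto_intros)
  then have lim: "((\<lambda>X. 2 * b\<^sup>2 * norm R * norm (X - Q)) \<longlongrightarrow> 0) (at Q)"
    by simp
  have "((\<lambda>X. norm (matrix_inv X - R - - (R ** ((X - Q) ** R))) / norm (X - Q)) \<longlongrightarrow> 0) (at Q)"
    by (rule tendsto_sandwich[OF _ ev tendsto_const lim]) auto
  with lin show ?thesis
    by (simp add: has_derivative_iff_norm R_def)
qed

lemma has_derivative_matrix_conjugate:
  fixes A Q :: "'a::{real_normed_field,euclidean_space}^'n^'n"
  assumes Q: "invertible Q"
  shows "((\<lambda>X. matrix_inv X ** A ** X) has_derivative
    (\<lambda>H. mat_commutator (matrix_inv Q ** A ** Q) (matrix_inv Q ** H))) (at Q)"
proof -
  let ?R = "matrix_inv Q"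
  note mult_deriv = bounded_bilinear.FDERIV[OF bounded_bilinear_matrix_mult]
  \<comment> \<open>The summand \<open>0 ** Q\<close> is the contribution of the constant factor \<open>A\<close> to the product rule.\<close>
  have "((\<lambda>X. matrix_inv X ** (A ** X)) has_derivative
      (\<lambda>H. ?R ** (A ** H + 0 ** Q) + - (?R ** (H ** ?R)) ** (A ** Q))) (at Q)"
    by (intro mult_deriv has_derivative_matrix_inv[OF Q] has_derivative_const has_derivative_ident)
  moreover have "?R ** (A ** H + 0 ** Q) + - (?R ** (H ** ?R)) ** (A ** Q)
      = mat_commutator (?R ** A ** Q) (?R ** H)" for H
  proof -
    \<comment> \<open>Exposes the cancelling factor \<open>Q Q\<^sup>-\<^sup>1\<close> inside \<open>D (Q\<^sup>-\<^sup>1 H)\<close>.\<close>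
    have "?R ** A ** Q ** (?R ** H) = ?R ** A ** (Q ** ?R) ** H"
      by (simp only: matrix_mul_assoc)
    then show ?thesis
      by (simp add: mat_commutator_def matrix_inv_mult[OF Q] matrix_mult_minus_left matrix_mul_assoc)
  qed
  ultimately show ?thesis
    by (simp add: matrix_mul_assoc)
qed

section \<open>Adjoints for the Frobenius scalar product\<close>

text \<open>The common form of the two adjoints: the transpose when \<open>c\<close> is the identity, the conjugate
  transpose when \<open>c\<close> is complex conjugation.\<close>

definition twisted_transpose :: "('a \<Rightarrow> 'a) \<Rightarrow> 'a^'n^'m \<Rightarrow> 'a^'m^'n" where
  "twisted_transpose c X = (\<chi> i j. c (X $ j $ i))"

lemma inner_matrix_mult_left:
  fixes X :: "'a::{real_normed_field,euclidean_space}^'n^'m"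
  assumes c: "\<And>a x y :: 'a. inner (a * x) y = inner x (c a * y)"
  shows "inner (X ** Y) Z = inner Y (twisted_transpose c X ** Z)"
proof -
  have "inner (X ** Y) Z
      = (\<Sum>i\<in>UNIV. \<Sum>j\<in>UNIV. \<Sum>k\<in>UNIV. inner (Y $ k $ j) (c (X $ i $ k) * Z $ i $ j))"
    by (simp add: inner_vec_def matrix_matrix_mult_def inner_sum_left c)
  also have "\<dots> = (\<Sum>i\<in>UNIV. \<Sum>k\<in>UNIV. \<Sum>j\<in>UNIV. inner (Y $ k $ j) (c (X $ i $ k) * Z $ i $ j))"
    by (intro sum.cong refl sum.swap)
  also have "\<dots> = (\<Sum>k\<in>UNIV. \<Sum>i\<in>UNIV. \<Sum>j\<in>UNIV. inner (Y $ k $ j) (c (X $ i $ k) * Z $ i $ j))"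
    by (rule sum.swap)
  also have "\<dots> = (\<Sum>k\<in>UNIV. \<Sum>j\<in>UNIV. \<Sum>i\<in>UNIV. inner (Y $ k $ j) (c (X $ i $ k) * Z $ i $ j))"
    by (intro sum.cong refl sum.swap)
  also have "\<dots> = inner Y (twisted_transpose c X ** Z)"
    by (simp add: inner_vec_def matrix_matrix_mult_def inner_sum_right twisted_transpose_def)
  finally show ?thesis .
qed

lemma inner_matrix_mult_right:
  fixes X :: "'a::{real_normed_field,euclidean_space}^'p^'n"
  assumes c: "\<And>a x y :: 'a. inner (a * x) y = inner x (c a * y)"
  shows "inner (Y ** X) Z = inner Y (Z ** twisted_transpose c X)"
proof -
  have c': "inner (x * a) y = inner x (y * c a)" for a x y
    using c[of a x y] by (simp add: mult.commute)
  have "inner (Y ** X) Z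
      = (\<Sum>i\<in>UNIV. \<Sum>j\<in>UNIV. \<Sum>k\<in>UNIV. inner (Y $ i $ k) (Z $ i $ j * c (X $ k $ j)))"
    by (simp add: inner_vec_def matrix_matrix_mult_def inner_sum_left c')
  also have "\<dots> = (\<Sum>i\<in>UNIV. \<Sum>k\<in>UNIV. \<Sum>j\<in>UNIV. inner (Y $ i $ k) (Z $ i $ j * c (X $ k $ j)))"
    by (intro sum.cong refl sum.swap)
  also have "\<dots> = inner Y (Z ** twisted_transpose c X)"
    by (simp add: inner_vec_def matrix_matrix_mult_def inner_sum_right twisted_transpose_def)
  finally show ?thesis .
qed

lemma inner_mat_commutator:
  fixes D W M :: "'a::{real_normed_field,euclidean_space}^'n^'n"
  assumes c: "\<And>a x y :: 'a. inner (a * x) y = inner x (c a * y)"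
  shows "inner (mat_commutator D W) M = inner W (mat_commutator (twisted_transpose c D) M)"
  by (simp add: mat_commutator_def inner_diff_left inner_diff_right
      inner_matrix_mult_left[OF c, of D] inner_matrix_mult_right[OF c, of _ D])

section \<open>The gradient of the off-diagonal energy\<close>

text \<open>Taking the off-diagonal part is a self-adjoint projection, so one of the two factors may be
  left unprojected.\<close>

lemma inner_hadamard_offdiag:
  fixes M N :: "'a::{real_normed_field,euclidean_space}^'n^'n"
  shows "inner (M \<diamondop> offdiag_ones) (N \<diamondop> offdiag_ones) = inner M (N \<diamondop> offdiag_ones)"
  by (auto simp: inner_vec_def hadamard_def offdiag_ones_def intro!: sum.cong)

lemma sum_norm_offdiag_eq_inner:
  fixes M :: "'a::{real_normed_field,euclidean_space}^'n^'n"
  shows "(\<Sum>(i, j) \<in> {(i, j). i \<noteq> j}. (norm (M $ i $ j))\<^sup>2)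
    = inner (M \<diamondop> offdiag_ones) (M \<diamondop> offdiag_ones)"
proof -
  have "(\<Sum>(i, j) \<in> {(i, j). i \<noteq> j}. (norm (M $ i $ j))\<^sup>2)
      = (\<Sum>(i, j) \<in> UNIV \<times> UNIV. if i = j then 0 else inner (M $ i $ j) (M $ i $ j))"
    by (rule sum.mono_neutral_cong_left) (auto simp: power2_norm_eq_inner)
  also have "\<dots> = inner (M \<diamondop> offdiag_ones) (M \<diamondop> offdiag_ones)"
    unfolding sum.cartesian_product[symmetric]
    by (auto simp: inner_vec_def hadamard_def offdiag_ones_def intro!: sum.cong)
  finally show ?thesis .
qed

lemma bounded_linear_hadamard_offdiag:
  "bounded_linear (\<lambda>M :: 'a::{real_normed_field,euclidean_space}^'n^'n. M \<diamondop> offdiag_ones)"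
  by (intro linear_conv_bounded_linear[THEN iffD1] linearI)
    (auto simp: hadamard_def vec_eq_iff algebra_simps)

lemma GDERIV_offdiag_energy:
  fixes A Q :: "'a::{real_normed_field,euclidean_space}^'n^'n"
  assumes c: "\<And>a x y :: 'a. inner (a * x) y = inner x (c a * y)"
    and Q: "invertible Q"
  defines "D \<equiv> matrix_inv Q ** A ** Q"
  shows "GDERIV (\<lambda>X. 1/2 * (\<Sum>(i, j) \<in> {(i, j). i \<noteq> j}.
        (norm ((matrix_inv X ** A ** X) $ i $ j))\<^sup>2)) Q :>
      twisted_transpose c (matrix_inv Q) **
        mat_commutator (twisted_transpose c D) (D \<diamondop> offdiag_ones)"
proof -
  let ?F = "\<lambda>X. (matrix_inv X ** A ** X) \<diamondop> offdiag_ones"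
  let ?F' = "\<lambda>H. mat_commutator D (matrix_inv Q ** H) \<diamondop> offdiag_ones"
  have "(?F has_derivative ?F') (at Q)"
    using bounded_linear.has_derivative[OF bounded_linear_hadamard_offdiag
        has_derivative_matrix_conjugate[OF Q]]
    by (simp add: D_def)
  then have "((\<lambda>X. 1/2 * inner (?F X) (?F X)) has_derivative
      (\<lambda>H. 1/2 * (inner (?F Q) (?F' H) + inner (?F' H) (?F Q)))) (at Q)"
    by (intro has_derivative_mult_right has_derivative_inner)
  moreover have "1/2 * (inner (?F Q) (?F' H) + inner (?F' H) (?F Q))
      = inner H (twisted_transpose c (matrix_inv Q) **
          mat_commutator (twisted_transpose c D) (D \<diamondop> offdiag_ones))" for H
  proof -
    have "1/2 * (inner (?F Q) (?F' H) + inner (?F' H) (?F Q)) = inner (?F' H) (D \<diamondop> offdiag_ones)"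
      by (simp add: D_def inner_commute)
    also have "\<dots> = inner (mat_commutator D (matrix_inv Q ** H)) (D \<diamondop> offdiag_ones)"
      by (rule inner_hadamard_offdiag)
    also have "\<dots> = inner (matrix_inv Q ** H)
        (mat_commutator (twisted_transpose c D) (D \<diamondop> offdiag_ones))"
      by (rule inner_mat_commutator[OF c])
    also have "\<dots> = inner H (twisted_transpose c (matrix_inv Q) **
        mat_commutator (twisted_transpose c D) (D \<diamondop> offdiag_ones))"
      by (rule inner_matrix_mult_left[OF c])
    finally show ?thesis .
  qed
  ultimately show ?thesis
    by (simp add: gderiv_def sum_norm_offdiag_eq_inner)
qed

lemma GDERIV_offdiag_fun:
  fixes A :: "nat \<Rightarrow> 'a::{real_normed_field,euclidean_space}^'n^'n"
  assumes c: "\<And>a x y :: 'a. inner (a * x) y = inner x (c a * y)"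
    and Q: "invertible Q"
    and D: "\<And>k. k \<in> {1..K} \<Longrightarrow> D k = matrix_inv Q ** A k ** Q"
  shows "GDERIV (offdiag_fun K A) Q :>
      (\<Sum>k = 1..K. twisted_transpose c (matrix_inv Q) **
        mat_commutator (twisted_transpose c (D k)) (D k \<diamondop> offdiag_ones))"
proof -
  have "((\<lambda>X. \<Sum>k = 1..K. 1/2 * (\<Sum>(i, j) \<in> {(i, j). i \<noteq> j}.
        (norm ((matrix_inv X ** A k ** X) $ i $ j))\<^sup>2)) has_derivative
      (\<lambda>H. \<Sum>k = 1..K. inner H (twisted_transpose c (matrix_inv Q) **
        mat_commutator (twisted_transpose c (D k)) (D k \<diamondop> offdiag_ones)))) (at Q)"
    using GDERIV_offdiag_energy[OF c Q] by (intro has_derivative_sum) (simp add: gderiv_def D)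
  then show ?thesis
    unfolding gderiv_def offdiag_fun_def sum_distrib_left inner_sum_right .
qed

lemma inner_real_mult_left: "inner (a * x) y = inner x (a * y)" for a x y :: real
  by simp

lemma inner_complex_mult_left: "inner (a * x) y = inner x (cnj a * y)" for a x y :: complex
  by (simp add: inner_complex_def algebra_simps)

theorem theorem5p1:
  fixes K :: nat
  shows "(\<forall>(A :: nat \<Rightarrow> real ^ 'n ^ 'n) (Q :: real ^ 'n ^ 'n) (D :: nat \<Rightarrow> real ^ 'n ^ 'n).
            invertible Q \<longrightarrow> (\<forall>k\<in>{1..K}. D k = matrix_inv Q ** A k ** Q) \<longrightarrow>
            GDERIV (offdiag_fun K A) Q :>
              (\<Sum>k = 1..K. transpose (matrix_inv Q) **
                 mat_commutator (transpose (D k)) (D k \<diamondop> offdiag_ones)))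
       \<and> (\<forall>(A :: nat \<Rightarrow> complex ^ 'n ^ 'n) (Q :: complex ^ 'n ^ 'n) (D :: nat \<Rightarrow> complex ^ 'n ^ 'n).
            invertible Q \<longrightarrow> (\<forall>k\<in>{1..K}. D k = matrix_inv Q ** A k ** Q) \<longrightarrow>
            GDERIV (offdiag_fun K A) Q :>
              (\<Sum>k = 1..K. conj_transpose (matrix_inv Q) **
                 mat_commutator (conj_transpose (D k)) (D k \<diamondop> offdiag_ones)))"
proof (intro conjI allI impI)
  fix A D :: "nat \<Rightarrow> real ^ 'n ^ 'n" and Q :: "real ^ 'n ^ 'n"
  assume "invertible Q" "\<forall>k\<in>{1..K}. D k = matrix_inv Q ** A k ** Q"
  then show "GDERIV (offdiag_fun K A) Q :>
      (\<Sum>k = 1..K. transpose (matrix_inv Q) **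
         mat_commutator (transpose (D k)) (D k \<diamondop> offdiag_ones))"
    using GDERIV_offdiag_fun[OF inner_real_mult_left, of Q K D A]
    by (simp add: twisted_transpose_def transpose_def)
next
  fix A D :: "nat \<Rightarrow> complex ^ 'n ^ 'n" and Q :: "complex ^ 'n ^ 'n"
  assume "invertible Q" "\<forall>k\<in>{1..K}. D k = matrix_inv Q ** A k ** Q"
  then show "GDERIV (offdiag_fun K A) Q :>
      (\<Sum>k = 1..K. conj_transpose (matrix_inv Q) **
         mat_commutator (conj_transpose (D k)) (D k \<diamondop> offdiag_ones))"
    using GDERIV_offdiag_fun[OF inner_complex_mult_left, of Q K D A]
    by (simp add: twisted_transpose_def conj_transpose_def)
qed

end
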